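(* Let $Z$ be a nonempty closed convex subset of $H$, let $x_0\in L^2(\Omega,\mathcal{F},P;H)$, and let $(x_n)_{n\in\mathbb{N}}$ be a sequence generated by the following iteration: for every $n\in\mathbb{N}$, - take $a_n\in L^2(\Omega,\mathcal{F},P;H)$ such that $Z\subset H(x_n,a_n)$ $P$-a.s.; - take $\lambda_n\in L^\infty(\Omega,\mathcal{F},P;\left]0,1\right])$; - set $r_n=x_n+\lambda_n(a_n-x_n)$; - set $x_{n+1}=Q(x_0,x_n,r_n)$. For every $n\in\mathbb{N}$, set $\mathcal{X}_n=\sigma(x_0,\ldots,x_n)$. Then the following hold: (i) $(x_n)_{n\in\mathbb{N}}$ is a well-defined sequence in $L^2(\Omega,\mathcal{F},P;H)$. (ii) For every $n\in\mathbb{N}$, $Z\subset H(x_0,x_n)\cap H(x_n,r_n)$ $P$-a.s. (iii) There exists $\ell\in L^2(\Omega,\mathcal{F},P;\mathbb{R})$ such that $\|x_n-x_0\|_H\uparrow\ell\leq\|\mathrm{proj}_Z x_0-x_0\|_H$ $P$-a.s. (iv) $(\|x_n\|_H)_{n\in\mathbb{N}}$ is bounded $P$-a.s. (v) $\sum_{n\in\mathbb{N}}\mathsf{E}\|x_{n+1}-x_n\|_H^2<+\infty$ and $\sum_{n\in\mathbb{N}}\mathsf{E}\big(\|x_{n+1}-x_n\|_H^2\,\big|\,\mathcal{X}_n\big)<+\infty$ $P$-a.s. (vi) $\sum_{n\in\mathbb{N}}\mathsf{E}\big(\lambda_n^2\|a_n-x_n\|_H^2\big)<+\infty$ and $\sum_{n\in\mathbb{N}}\mathsf{E}\big(\lambda_n^2\|a_n-x_n\|_H^2\,\big|\,\mathcal{X}_n\big)<+\infty$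 $P$-a.s. (vii) Suppose that $\mathfrak{W}(x_n)_{n\in\mathbb{N}}\subset Z$ $P$-a.s. Then $(x_n)_{n\in\mathbb{N}}$ converges strongly $P$-a.s. and strongly in $L^2(\Omega,\mathcal{F},P;H)$ to $\mathrm{proj}_Z x_0$.
   Context: $H$ is a separable real Hilbert space with scalar product $\langle\cdot\mid\cdot\rangle_H$, norm $\|\cdot\|_H$, and Borel $\sigma$-algebra $\mathcal{B}_H$. $(\Omega,\mathcal{F},P)$ is a complete probability space and $\mathsf{E}$ denotes (conditional) expectation. $L^2(\Omega,\mathcal{F},P;H)$ is the Hilbert space of ($P$-a.s. equivalence classes of) measurable maps $x\colon(\Omega,\mathcal{F})\to(H,\mathcal{B}_H)$ with $\mathsf{E}\|x\|_H^2<+\infty$. $L^\infty(\Omega,\mathcal{F},P;\left]0,1\right])$ is the set of essentially bounded real random variables with values in $\left]0,1\right]$. $\sigma(x_0,\ldots,x_n)$ is the sub-$\sigma$-algebra of $\mathcal{F}$ generated by $x_0,\ldots,x_n$. $\mathrm{proj}_C$ is the projection operator onto a nonempty closed convex set $C\subset H$, and $\mathrm{proj}_Zx_0$ is the random variable $\omega\mapsto\mathrm{proj}_Z(x_0(\omega))$. For $(\mathsf{x},\mathsf{y},\mathsf{z})\in H^3$ define $$H(\mathsf{x},\mathsf{y})=\{\mathsf{w}\in H\mid\langle \mathsf{w}-\mathsf{y}\mid \mathsf{x}-\mathsf{y}\rangle_H\leq0\},$$ $$O(\mathsf{x},\mathsf{y},\mathsf{z})=\begin{cases}H(\mathsf{x},\mathsf{y})\cap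 H(\mathsf{y},\mathsf{z}),&\text{if }H(\mathsf{x},\mathsf{y})\cap H(\mathsf{y},\mathsf{z})\neq\varnothing;\\ \{\mathsf{y}\},&\text{if }H(\mathsf{x},\mathsf{y})\cap H(\mathsf{y},\mathsf{z})=\varnothing,\end{cases}$$ $$Q(\mathsf{x},\mathsf{y},\mathsf{z})=\mathrm{proj}_{O(\mathsf{x},\mathsf{y},\mathsf{z})}\mathsf{x}.$$ Applied to $H$-valued random variables, these are understood pointwise in $\omega$; e.g. $Z\subset H(x,y)$ $P$-a.s. means that $Z\subset H(x(\omega),y(\omega))$ for $P$-almost every $\omega$, and $Q(x,y,z)$ is $\omega\mapsto Q(x(\omega),y(\omega),z(\omega))$. The notation $\xi_n\uparrow\ell$ $P$-a.s. means that, $P$-a.s., $(\xi_n)_{n\in\mathbb{N}}$ is nondecreasing and converges to $\ell$. $\mathfrak{W}(\mathsf{x}_n)_{n\in\mathbb{N}}$ is the set of weak sequential cluster points of a sequence $(\mathsf{x}_n)_{n\in\mathbb{N}}$ in $H$; $\mathfrak{W}(x_n)_{n\in\mathbb{N}}\subset Z$ $P$-a.s. means that $\mathfrak{W}(x_n(\omega))_{n\in\mathbb{N}}\subset Z$ for $P$-almost every $\omega$. *)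

theory Defs
  imports "HOL-Probability.Probability"
begin

text \<open>
  Separable real Hilbert spaces are the types of sort
  \<open>{real_inner, complete_space, second_countable_topology}\<close>; for a metric space,
  second countability is separability. Random variables are represented by functions
  rather than by classes modulo almost sure equality.
\<close>

definition nearest_point :: "'h::real_inner set \<Rightarrow> 'h \<Rightarrow> 'h \<Rightarrow> bool" where
  "nearest_point C x p \<longleftrightarrow> p \<in> C \<and> (\<forall>w\<in>C. norm (x - p) \<le> norm (x - w))"

text \<open>The library's \<open>closest_point\<close> is restricted to Heine-Borel spaces, that is, to
  finite dimension.\<close>

definition proj_onto :: "'h::real_inner set \<Rightarrow> 'h \<Rightarrow> 'h" where
  "proj_onto C x = (THE p. nearest_point C x p)"

definition half_H :: "'h::real_inner \<Rightarrow> 'h \<Rightarrow> 'h set" where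
  "half_H x y = {w. (w - y) \<bullet> (x - y) \<le> 0}"

definition outer_O :: "'h::real_inner \<Rightarrow> 'h \<Rightarrow> 'h \<Rightarrow> 'h set" where
  "outer_O x y z =
     (if half_H x y \<inter> half_H y z \<noteq> {} then half_H x y \<inter> half_H y z else {y})"

definition haugazeau_Q :: "'h::real_inner \<Rightarrow> 'h \<Rightarrow> 'h \<Rightarrow> 'h" where
  "haugazeau_Q x y z = proj_onto (outer_O x y z) x"

definition weakly_converges :: "(nat \<Rightarrow> 'h::real_inner) \<Rightarrow> 'h \<Rightarrow> bool" where
  "weakly_converges s w \<longleftrightarrow> (\<forall>u. (\<lambda>n. s n \<bullet> u) \<longlonglongrightarrow> w \<bullet> u)"

definition weak_cluster_points :: "(nat \<Rightarrow> 'h::real_inner) \<Rightarrow> 'h set" where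
  "weak_cluster_points s =
     {w. \<exists>k::nat \<Rightarrow> nat. strict_mono k \<and> weakly_converges (s \<circ> k) w}"

definition L2 :: "'w measure \<Rightarrow> ('w \<Rightarrow> 'h::real_normed_vector) set" where
  "L2 M = {f \<in> borel_measurable M. integrable M (\<lambda>\<omega>. (norm (f \<omega>))\<^sup>2)}"

definition converges_in_L2 ::
  "'w measure \<Rightarrow> (nat \<Rightarrow> 'w \<Rightarrow> 'h::real_normed_vector) \<Rightarrow> ('w \<Rightarrow> 'h) \<Rightarrow> bool" where
  "converges_in_L2 M f g \<longleftrightarrow>
     (\<forall>n. f n \<in> L2 M) \<and> g \<in> L2 M \<and>
     (\<lambda>n. sqrt (\<integral>\<omega>. (norm (f n \<omega> - g \<omega>))\<^sup>2 \<partial>M)) \<longlonglongrightarrow> 0"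

definition Linfty :: "'w measure \<Rightarrow> real set \<Rightarrow> ('w \<Rightarrow> real) set" where
  "Linfty M S = {f \<in> borel_measurable M.
     (AE \<omega> in M. f \<omega> \<in> S) \<and> (\<exists>C. AE \<omega> in M. \<bar>f \<omega>\<bar> \<le> C)}"

definition generated_sigma ::
  "'w measure \<Rightarrow> (nat \<Rightarrow> 'w \<Rightarrow> 'h::topological_space) \<Rightarrow> nat \<Rightarrow> 'w measure" where
  "generated_sigma M x n =
     sigma (space M) {x i -` A \<inter> space M | i A. i \<le> n \<and> A \<in> sets borel}"

end

theory Submission
  imports Defs "HOL-Library.Diagonal_Subsequence"
begin

text \<open>
  Almost every path is a deterministic Haugazeau sequence, along which \<open>Z\<close> stays inside both
  half-spaces. Since \<open>x (Suc n)\<close> lies in \<open>half_H (x 0) (x n)\<close>, the squared step length is at most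
  the increment of \<open>(norm (x n - x 0))\<^sup>2\<close>, so the steps telescope, with total at most
  \<open>(norm (w - x 0))\<^sup>2\<close> for any \<open>w \<in> Z\<close>; and \<open>x (Suc n) \<in> half_H (x n) (r n)\<close> bounds the
  relaxation step by the actual step. Likewise, for \<open>p\<close> the projection of \<open>x 0\<close> onto \<open>Z\<close>,
  \<open>(norm (p - x n))\<^sup>2 \<le> (norm (p - x 0))\<^sup>2 - (norm (x n - x 0))\<^sup>2\<close>, where the right-hand side is
  nonincreasing. Hence a single weak cluster point in \<open>Z\<close>, which must be \<open>p\<close> and
  forces \<open>norm (x n - x 0)\<close> up to \<open>norm (p - x 0)\<close>, yields strong convergence of the
  whole sequence. Convergence in \<open>L2\<close> is then dominated convergence.
\<close>

subsection \<open>Projections and weak compactness in Hilbert space\<close>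

text \<open>The parallelogram law for \<open>x - p\<close> and \<open>x - q\<close>. It turns nearly
  minimal distances to a convex set into a bound on \<open>norm (p - q)\<close>.\<close>

lemma midpoint_norm_identity:
  fixes x p q :: "'a::real_inner"
  shows "(norm (p - q))\<^sup>2 =
    2 * (norm (x - p))\<^sup>2 + 2 * (norm (x - q))\<^sup>2 - 4 * (norm (x - midpoint p q))\<^sup>2"
proof -
  have "2 *\<^sub>R (x - midpoint p q) = (x - p) + (x - q)"
    by (simp add: midpoint_def scaleR_diff_right scaleR_2)
  then have "(norm (2 *\<^sub>R (x - midpoint p q)))\<^sup>2 = (norm ((x - p) + (x - q)))\<^sup>2"
    by simp
  then show ?thesis
    by (simp add: power2_norm_eq_inner inner_simps inner_commute power_mult_distrib)
qed

text \<open>Near-minimizers of the distance from \<open>x\<close> to \<open>C n\<close> form a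
  Cauchy sequence, because convexity keeps their midpoints in the sets. The constant sequence yields
  projections; closed convex hulls of tails will yield weak limits.\<close>

lemma decreasing_convex_sets_common_point:
  fixes C :: "nat \<Rightarrow> 'a::{real_inner, complete_space} set"
  assumes "decseq C" and closed: "\<And>n. closed (C n)" and conv: "\<And>n. convex (C n)"
    and ne: "\<And>n. C n \<noteq> {}" and bound: "\<And>n. infdist x (C n) \<le> B"
  shows "\<exists>p. (\<forall>n. p \<in> C n) \<and> dist x p \<le> B"
proof -
  define d where "d n = infdist x (C n)" for n
  have sub: "C n \<subseteq> C m" if "m \<le> n" for m n
    using \<open>decseq C\<close> that by (auto simp: decseq_def)
  have "incseq d"
    unfolding incseq_def d_def using ne sub by (auto intro!: infdist_mono)
  moreover have "d n \<le> B" for n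
    using bound by (simp add: d_def)
  ultimately obtain D where D: "d \<longlonglongrightarrow> D" "\<And>n. d n \<le> D"
    using incseq_convergent by metis
  have D_le: "D \<le> B"
    using D(1) \<open>\<And>n. d n \<le> B\<close> by (intro LIMSEQ_le_const2) auto
  have d_nonneg: "0 \<le> d n" for n
    by (simp add: d_def infdist_nonneg)
  have "\<exists>p\<in>C n. dist x p < d n + 1 / Suc n" for n
  proof (rule ccontr)
    assume "\<not> ?thesis"
    then have "d n + 1 / Suc n \<le> infdist x (C n)"
      using ne[of n] by (auto simp: infdist_def not_less intro!: cINF_greatest)
    then show False
      by (simp add: d_def)
  qed
  then obtain p where p: "\<And>n. p n \<in> C n" "\<And>n. dist x (p n) < d n + 1 / Suc n"
    by metis
  \<comment> \<open>Since \<open>d\<close> increases, \<open>d n + 1 / Suc n\<close> need not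
    decrease. With \<open>d n\<close> replaced by its limit, the bound at \<open>m\<close> controls
    every later near-minimizer.\<close>
  define e where "e n = D + 1 / real (Suc n)" for n
  have e_lim: "e \<longlonglongrightarrow> D"
    unfolding e_def using tendsto_add[OF tendsto_const[of D] lim_1_over_n[THEN LIMSEQ_Suc]] by simp
  have p_e: "dist x (p n) \<le> e m" if "m \<le> n" for m n
  proof -
    have "1 / real (Suc n) \<le> 1 / real (Suc m)"
      using that by (simp add: frac_le)
    then show ?thesis
      using p(2)[of n] D(2)[of n] by (simp add: e_def)
  qed
  have key: "(dist (p m) (p n))\<^sup>2 \<le> 4 * ((e k)\<^sup>2 - (d k)\<^sup>2)" if "k \<le> m" "k \<le> n" for k m n
  proof -
    have "p m \<in> C k" "p n \<in> C k"
      using p(1) sub that by blast+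
    then have "midpoint (p m) (p n) \<in> C k"
      using conv[of k] unfolding midpoint_def scaleR_add_right
      by (intro convexD) auto
    \<comment> \<open>The midpoint is at distance at least \<open>d k\<close> from \<open>x\<close>
      and both endpoints are within \<open>e k\<close>, so the parallelogram law leaves only the gap
      between the two squares.\<close>
    then have "d k \<le> norm (x - midpoint (p m) (p n))"
      unfolding d_def by (metis dist_norm infdist_le)
    then have "(d k)\<^sup>2 \<le> (norm (x - midpoint (p m) (p n)))\<^sup>2"
      using d_nonneg by (intro power_mono)
    moreover have "(norm (x - p m))\<^sup>2 \<le> (e k)\<^sup>2" "(norm (x - p n))\<^sup>2 \<le> (e k)\<^sup>2"
      using p_e that by (auto intro!: power_mono simp: dist_norm)
    ultimately show ?thesis
      using midpoint_norm_identity[of "p m" "p n" x] unfolding dist_norm right_diff_distrib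
      by linarith
  qed
  have "(\<lambda>k. 4 * ((e k)\<^sup>2 - (d k)\<^sup>2)) \<longlonglongrightarrow> 4 * (D\<^sup>2 - D\<^sup>2)"
    by (intro tendsto_intros e_lim D)
  then have gap: "(\<lambda>k. 4 * ((e k)\<^sup>2 - (d k)\<^sup>2)) \<longlonglongrightarrow> 0"
    by simp
  have "Cauchy p"
  proof (rule metric_CauchyI)
    fix \<epsilon> :: real assume "0 < \<epsilon>"
    then have "eventually (\<lambda>k. 4 * ((e k)\<^sup>2 - (d k)\<^sup>2) < \<epsilon>\<^sup>2) sequentially"
      using gap by (intro order_tendstoD) auto
    then obtain k where k: "4 * ((e k)\<^sup>2 - (d k)\<^sup>2) < \<epsilon>\<^sup>2"
      using eventually_happens by force
    have "dist (p m) (p n) < \<epsilon>" if "k \<le> m" "k \<le> n" for m n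
    proof (rule power2_less_imp_less)
      show "(dist (p m) (p n))\<^sup>2 < \<epsilon>\<^sup>2"
        using key[OF that] k by linarith
    qed (use \<open>0 < \<epsilon>\<close> in simp)
    then show "\<exists>N. \<forall>m\<ge>N. \<forall>n\<ge>N. dist (p m) (p n) < \<epsilon>"
      by blast
  qed
  then obtain q where q: "p \<longlonglongrightarrow> q"
    using Cauchy_convergent convergent_def by blast
  have "q \<in> C n" for n
  proof (rule Lim_in_closed_set[OF closed _ _ q])
    show "eventually (\<lambda>k. p k \<in> C n) sequentially"
      using eventually_ge_at_top[of n] by eventually_elim (use p(1) sub in blast)
  qed simp
  moreover have "dist x q \<le> D"
    using p_e[OF order_refl] by (intro LIMSEQ_le[OF tendsto_dist[OF tendsto_const q] e_lim]) auto
  ultimately show ?thesis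
    using D_le by (meson order_trans)
qed

section \<open>Existence and variational characterization of projections\<close>

lemma nearest_point_dist:
  "nearest_point C x p \<longleftrightarrow> p \<in> C \<and> (\<forall>w\<in>C. dist x p \<le> dist x w)"
  by (simp add: nearest_point_def dist_norm)

lemma ex1_nearest_point:
  fixes C :: "'a::{real_inner, complete_space} set"
  assumes "C \<noteq> {}" "closed C" "convex C"
  shows "\<exists>!p. nearest_point C x p"
proof -
  have "\<exists>p. (\<forall>n::nat. p \<in> C) \<and> dist x p \<le> infdist x C"
    using assms by (intro decreasing_convex_sets_common_point) (auto simp: decseq_def)
  then obtain p where p: "p \<in> C" "dist x p \<le> infdist x C"
    by blast
  then have "nearest_point C x p"
    unfolding nearest_point_dist by (meson infdist_le order_trans)
  moreover have "q = q'" if "nearest_point C x q" "nearest_point C x q'" for q q'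
    using that any_closest_point_unique[OF assms(3,2), of q q' x]
    by (auto simp: nearest_point_dist)
  ultimately show ?thesis
    by blast
qed

lemma nearest_point_proj_onto:
  fixes C :: "'a::{real_inner, complete_space} set"
  assumes "C \<noteq> {}" "closed C" "convex C"
  shows "nearest_point C x (proj_onto C x)"
  unfolding proj_onto_def by (rule theI'[OF ex1_nearest_point[OF assms]])

text \<open>The variational inequality for projections: the angle at \<open>p\<close> between
  \<open>x\<close> and any point of \<open>C\<close> is not acute. Conversely, this angle condition
  gives a Pythagorean inequality and hence minimality.\<close>

lemma nearest_point_iff_half_H:
  fixes C :: "'a::real_inner set"
  assumes "closed C" "convex C"
  shows "nearest_point C x p \<longleftrightarrow> p \<in> C \<and> C \<subseteq> half_H x p"
proof (intro iffI conjI)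
  assume p: "nearest_point C x p"
  then show "p \<in> C"
    by (simp add: nearest_point_def)
  with p show "C \<subseteq> half_H x p"
    using any_closest_point_dot[OF assms(2,1), of p _ x]
    by (auto simp: nearest_point_dist half_H_def inner_commute)
next
  assume *: "p \<in> C \<and> C \<subseteq> half_H x p"
  have "norm (x - p) \<le> norm (x - w)" if "w \<in> C" for w
  proof -
    have "(w - p) \<bullet> (x - p) \<le> 0"
      using * that by (auto simp: half_H_def)
    then have "(norm (x - p))\<^sup>2 + (norm (w - p))\<^sup>2 \<le> (norm (x - w))\<^sup>2"
      by (simp add: power2_norm_eq_inner inner_simps inner_commute)
    then have "(norm (x - p))\<^sup>2 \<le> (norm (x - w))\<^sup>2"
      using zero_le_power2[of "norm (w - p)"] by linarith
    then show ?thesis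
      by (rule power2_le_imp_le) simp
  qed
  with * show "nearest_point C x p"
    by (auto simp: nearest_point_def)
qed

text \<open>Expanding the square of \<open>(w - y) - (x - y)\<close> leaves a cross term of
  favourable sign. All quantitative estimates along a path come from this inequality.\<close>

lemma half_H_pythagoras:
  assumes "w \<in> half_H x y"
  shows "(norm (w - y))\<^sup>2 + (norm (y - x))\<^sup>2 \<le> (norm (w - x))\<^sup>2"
  using assms by (simp add: half_H_def power2_norm_eq_inner inner_simps inner_commute)

lemma proj_onto_eqI:
  fixes C :: "'a::{real_inner, complete_space} set"
  assumes "closed C" "convex C" "p \<in> C" "C \<subseteq> half_H x p"
  shows "proj_onto C x = p"
  unfolding proj_onto_def
proof (rule the1_equality[OF ex1_nearest_point])
  show "nearest_point C x p"
    using assms by (simp add: nearest_point_iff_half_H)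
qed (use assms in auto)

text \<open>Add the variational inequalities at the two projections and apply Cauchy-Schwarz. The
  resulting continuity makes the random projection of \<open>x 0\<close> measurable.\<close>

lemma proj_onto_nonexpansive:
  fixes C :: "'a::{real_inner, complete_space} set"
  assumes "C \<noteq> {}" "closed C" "convex C"
  shows "norm (proj_onto C x - proj_onto C y) \<le> norm (x - y)"
proof -
  let ?p = "proj_onto C x" and ?q = "proj_onto C y"
  have "(?q - ?p) \<bullet> (x - ?p) \<le> 0" "(?p - ?q) \<bullet> (y - ?q) \<le> 0"
    using nearest_point_proj_onto[OF assms]
    by (auto simp: nearest_point_iff_half_H[OF assms(2,3)] half_H_def)
  then have "norm (?p - ?q) * norm (?p - ?q) \<le> (?p - ?q) \<bullet> (x - y)"
    by (simp add: power2_norm_eq_inner[symmetric] flip: power2_eq_square)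
       (simp add: power2_norm_eq_inner inner_simps inner_commute)
  also have "\<dots> \<le> norm (?p - ?q) * norm (x - y)"
    by (rule norm_cauchy_schwarz)
  finally show ?thesis
    by (metis mult_le_cancel_left_pos norm_ge_zero less_eq_real_def)
qed

lemma continuous_on_proj_onto:
  fixes C :: "'a::{real_inner, complete_space} set"
  assumes "C \<noteq> {}" "closed C" "convex C"
  shows "continuous_on A (proj_onto C)"
  unfolding continuous_on_iff dist_norm
  using proj_onto_nonexpansive[OF assms] by (meson order_le_less_trans)

section \<open>Weak sequential compactness\<close>

text \<open>A diagonal extraction makes the inner products with a countable dense set converge, and
  boundedness extends this to every vector.\<close>

lemma bounded_imp_weakly_convergent_subseq:
  fixes s :: "nat \<Rightarrow> 'a::{real_inner, complete_space, second_countable_topology}"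
  assumes "bounded (range s)"
  shows "\<exists>k w. strict_mono k \<and> weakly_converges (s \<circ> k) w"
proof -
  obtain B where B: "\<And>n. norm (s n) \<le> B" "0 < B"
    using assms unfolding bounded_pos by auto
  obtain D :: "'a set" where D: "countable D" "\<And>X. open X \<Longrightarrow> X \<noteq> {} \<Longrightarrow> \<exists>d\<in>D. d \<in> X"
    by (rule countable_dense_setE) blast
  have "D \<noteq> {}"
    using D(2)[of UNIV] by auto
  define d where "d = from_nat_into D"
  have d_range: "range d = D"
    using D(1) \<open>D \<noteq> {}\<close> by (simp add: d_def)
  let ?P = "\<lambda>n r. convergent (\<lambda>i. s (r i) \<bullet> d n)"
  interpret seq: subseqs ?P
  proof
    fix n :: nat and r :: "nat \<Rightarrow> nat"
    have "bounded (range (\<lambda>i. s (r i) \<bullet> d n))"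
    proof (rule boundedI)
      fix y assume "y \<in> range (\<lambda>i. s (r i) \<bullet> d n)"
      then obtain i where "y = s (r i) \<bullet> d n"
        by blast
      then show "norm y \<le> B * norm (d n)"
        using Cauchy_Schwarz_ineq2[of "s (r i)" "d n"] B(1)[of "r i"]
        by (simp add: order_trans[OF _ mult_right_mono])
    qed
    then obtain l r' where "strict_mono r'" "((\<lambda>i. s (r i) \<bullet> d n) \<circ> r') \<longlonglongrightarrow> l"
      using bounded_imp_convergent_subsequence by blast
    then show "\<exists>r'. strict_mono r' \<and> convergent (\<lambda>i. s ((r \<circ> r') i) \<bullet> d n)"
      by (auto simp: convergent_def o_def)
  qed
  define k where "k = seq.diagseq"
  define t where "t = s \<circ> k"
  have k: "strict_mono k"
    by (simp add: k_def seq.subseq_diagseq)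
  have conv_D: "convergent (\<lambda>i. t i \<bullet> d n)" for n
  proof -
    \<comment> \<open>The diagonal sequence is a subsequence of the \<open>n\<close>-th extraction
      only after its first \<open>Suc n\<close> terms, which do not affect convergence.\<close>
    have "?P n (k \<circ> ((+) (Suc n)))"
      unfolding k_def
    proof (rule seq.diagseq_holds)
      fix r q :: "nat \<Rightarrow> nat" and n assume "strict_mono r" "convergent (\<lambda>i. s (q i) \<bullet> d n)"
      then show "convergent (\<lambda>i. s ((q \<circ> r) i) \<bullet> d n)"
        using convergent_subseq_convergent[of "\<lambda>i. s (q i) \<bullet> d n" r] by (simp add: o_def)
    qed
    then show ?thesis
      using convergent_ignore_initial_segment[of "\<lambda>i. t i \<bullet> d n" "Suc n"]
      by (simp add: t_def o_def add.commute)
  qed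
  have t_le: "norm (t i) \<le> B" for i
    by (simp add: t_def B)
  have "convergent (\<lambda>i. t i \<bullet> u)" for u
  proof (rule Cauchy_convergent, rule metric_CauchyI)
    fix \<epsilon> :: real assume "0 < \<epsilon>"
    define \<delta> where "\<delta> = \<epsilon> / (4 * B)"
    have "0 < \<delta>"
      using \<open>0 < \<epsilon>\<close> B(2) by (simp add: \<delta>_def)
    then obtain n where n: "dist u (d n) < \<delta>"
      using D(2)[of "ball u \<delta>"] d_range by (auto simp: image_iff)
    have near: "\<bar>t i \<bullet> u - t i \<bullet> d n\<bar> \<le> \<epsilon> / 4" for i
    proof -
      have "\<bar>t i \<bullet> u - t i \<bullet> d n\<bar> = \<bar>t i \<bullet> (u - d n)\<bar>"
        by (simp add: inner_diff_right)
      also have "\<dots> \<le> norm (t i) * norm (u - d n)"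
        by (rule Cauchy_Schwarz_ineq2)
      also have "\<dots> \<le> B * \<delta>"
        using t_le n B(2) by (intro mult_mono) (auto simp: dist_norm)
      finally show ?thesis
        using B(2) by (simp add: \<delta>_def)
    qed
    obtain N where N: "\<And>i j. N \<le> i \<Longrightarrow> N \<le> j \<Longrightarrow> dist (t i \<bullet> d n) (t j \<bullet> d n) < \<epsilon> / 4"
      using metric_CauchyD[OF convergent_Cauchy[OF conv_D[of n]], of "\<epsilon> / 4"] \<open>0 < \<epsilon>\<close> by auto
    have "dist (t i \<bullet> u) (t j \<bullet> u) < \<epsilon>" if "N \<le> i" "N \<le> j" for i j
      using N[OF that] near[of i] near[of j] \<open>0 < \<epsilon>\<close> unfolding dist_real_def by linarith
    then show "\<exists>N. \<forall>i\<ge>N. \<forall>j\<ge>N. dist (t i \<bullet> u) (t j \<bullet> u) < \<epsilon>"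
      by blast
  qed
  then obtain f where f: "\<And>u. (\<lambda>i. t i \<bullet> u) \<longlonglongrightarrow> f u"
    unfolding convergent_def by metis
  \<comment> \<open>A common point of the closed convex hulls of the tails represents the limit functional
    \<open>f\<close>, which makes the Riesz representation theorem unnecessary.\<close>
  define C where "C n = closure (convex hull (t ` {n..}))" for n
  have t_in: "t n \<in> C n" for n
    unfolding C_def using closure_subset hull_subset by fastforce
  have "\<exists>w. (\<forall>n. w \<in> C n) \<and> dist 0 w \<le> B"
  proof (rule decreasing_convex_sets_common_point)
    show "decseq C"
      unfolding decseq_def C_def by (auto intro!: closure_mono hull_mono)
    show "closed (C n)" "convex (C n)" "C n \<noteq> {}" for n
      using t_in by (auto simp: C_def convex_closure)
    show "infdist 0 (C n) \<le> B" for n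
      using infdist_le[OF t_in, of 0 n] t_le[of n] by simp
  qed
  then obtain w where w: "\<And>n. w \<in> C n"
    by blast
  have "w \<bullet> u = f u" for u
  proof (rule ccontr)
    assume "w \<bullet> u \<noteq> f u"
    define \<epsilon> where "\<epsilon> = \<bar>w \<bullet> u - f u\<bar> / 2"
    have "0 < \<epsilon>"
      using \<open>w \<bullet> u \<noteq> f u\<close> by (simp add: \<epsilon>_def)
    then obtain N where N: "\<And>i. N \<le> i \<Longrightarrow> dist (t i \<bullet> u) (f u) < \<epsilon>"
      using metric_LIMSEQ_D[OF f] by blast
    \<comment> \<open>A closed convex slab containing a tail of \<open>t\<close> contains the closed
      hull of that tail, hence \<open>w\<close>; but its half-width is only half of the supposed
      discrepancy.\<close>
    define S where "S = (\<lambda>v. v \<bullet> u) -` cball (f u) \<epsilon>"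
    have "C N \<subseteq> S"
      unfolding C_def
    proof (intro closure_minimal hull_minimal)
      show "t ` {N..} \<subseteq> S"
        using N by (force simp: S_def dist_commute)
      show "convex S"
        unfolding S_def
        by (intro convex_linear_vimage bounded_linear.linear bounded_linear_inner_left convex_cball)
      show "closed S"
        unfolding S_def by (intro closed_vimage continuous_intros) auto
    qed
    then have "\<bar>w \<bullet> u - f u\<bar> \<le> \<epsilon>"
      using w[of N] by (auto simp: S_def dist_real_def)
    then show False
      using \<open>0 < \<epsilon>\<close> by (simp add: \<epsilon>_def)
  qed
  then have "weakly_converges (s \<circ> k) w"
    unfolding weakly_converges_def using f by (simp add: t_def)
  with k show ?thesis
    by blast
qed

subsection \<open>Haugazeau's operator\<close>

lemma outer_O_closed_convex:
  fixes x y z :: "'a::real_inner"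
  shows "outer_O x y z \<noteq> {}" "closed (outer_O x y z)" "convex (outer_O x y z)"
proof -
  have half: "half_H x y = {w. (x - y) \<bullet> w \<le> (x - y) \<bullet> y}" for x y :: 'a
    by (auto simp: half_H_def inner_simps inner_commute)
  have *: "closed (half_H x y)" "convex (half_H x y)" for x y :: 'a
    by (simp_all add: half closed_halfspace_le convex_halfspace_le)
  show "outer_O x y z \<noteq> {}" "closed (outer_O x y z)" "convex (outer_O x y z)"
    unfolding outer_O_def by (auto intro: closed_Int convex_Int *)
qed

text \<open>With \<open>u = x - y\<close> and \<open>v = y - z\<close>, the multipliers of the projection of \<open>x\<close> onto
  \<open>half_H x y \<inter> half_H y z\<close> are read off the Gram matrix of \<open>u\<close> and \<open>v\<close>. The explicit
  formula is what makes \<open>haugazeau_Q\<close> Borel measurable. The case \<open>\<rho> = 0\<close>, \<open>\<kappa> < 0\<close> is the one in which the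
  intersection is empty.\<close>

definition haugazeau_point :: "'a::real_inner \<Rightarrow> 'a \<Rightarrow> 'a \<Rightarrow> 'a" where
  "haugazeau_point x y z =
     (let u = x - y; v = y - z; \<kappa> = u \<bullet> v; \<mu> = u \<bullet> u; \<nu> = v \<bullet> v; \<rho> = \<mu> * \<nu> - \<kappa>\<^sup>2
      in if \<rho> = 0 then (if \<kappa> < 0 then y else z)
         else if \<rho> \<le> \<kappa> * \<nu> then x - (1 + \<kappa> / \<nu>) *\<^sub>R v
         else y + (\<nu> / \<rho>) *\<^sub>R (\<kappa> *\<^sub>R u - \<mu> *\<^sub>R v))"

text \<open>In each case of the formula, either the intersection is empty or the candidate is
  feasible and \<open>x\<close> minus the candidate is a nonnegative combination of the normals of
  the active constraints, which gives the variational inequality.\<close>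

lemma haugazeau_Q_eq:
  fixes x y z :: "'a::{real_inner, complete_space}"
  shows "haugazeau_Q x y z = haugazeau_point x y z"
proof -
  define u v where "u = x - y" and "v = y - z"
  define \<kappa> \<mu> \<nu> where "\<kappa> = u \<bullet> v" and "\<mu> = u \<bullet> u" and "\<nu> = v \<bullet> v"
  define \<rho> where "\<rho> = \<mu> * \<nu> - \<kappa>\<^sup>2"
  \<comment> \<open>Both constraints are taken relative to \<open>y\<close>; as
    \<open>z = y - v\<close>, the second one is shifted by \<nu>.\<close>
  have mem: "w \<in> half_H x y \<inter> half_H y z \<longleftrightarrow> (w - y) \<bullet> u \<le> 0 \<and> (w - y) \<bullet> v \<le> - \<nu>" for w
    by (auto simp: half_H_def u_def v_def \<nu>_def inner_simps inner_commute)
  have "0 \<le> \<mu>" "0 \<le> \<nu>"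
    by (simp_all add: \<mu>_def \<nu>_def)
  have "0 \<le> \<rho>"
    using Cauchy_Schwarz_ineq[of u v] by (simp add: \<rho>_def \<kappa>_def \<mu>_def \<nu>_def)
  have char: "haugazeau_Q x y z = p" if "(p - y) \<bullet> u \<le> 0" "(p - y) \<bullet> v \<le> - \<nu>"
      and var: "\<And>w. (w - y) \<bullet> u \<le> 0 \<Longrightarrow> (w - y) \<bullet> v \<le> - \<nu> \<Longrightarrow> (w - p) \<bullet> (x - p) \<le> 0" for p
  proof -
    have p: "p \<in> half_H x y \<inter> half_H y z"
      using that(1,2) mem by blast
    then have O: "outer_O x y z = half_H x y \<inter> half_H y z"
      by (auto simp: outer_O_def)
    show ?thesis
      unfolding haugazeau_Q_def
    proof (rule proj_onto_eqI)
      show "outer_O x y z \<subseteq> half_H x p"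
      proof
        fix w assume "w \<in> outer_O x y z"
        then have "(w - y) \<bullet> u \<le> 0" "(w - y) \<bullet> v \<le> - \<nu>"
          unfolding O using mem by blast+
        then show "w \<in> half_H x p"
          by (simp add: half_H_def var)
      qed
      show "p \<in> outer_O x y z"
        using p by (simp only: O)
    qed (rule outer_O_closed_convex)+
  qed
  have unfold: "haugazeau_point x y z =
      (if \<rho> = 0 then (if \<kappa> < 0 then y else z)
       else if \<rho> \<le> \<kappa> * \<nu> then x - (1 + \<kappa> / \<nu>) *\<^sub>R v
       else y + (\<nu> / \<rho>) *\<^sub>R (\<kappa> *\<^sub>R u - \<mu> *\<^sub>R v))"
    by (simp add: haugazeau_point_def Let_def u_def v_def \<kappa>_def \<mu>_def \<nu>_def \<rho>_def)
  have x_eq: "x = y + u" and z_eq: "z = y - v"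
    by (simp_all add: u_def v_def)
  \<comment> \<open>The equality case of Cauchy-Schwarz: a vanishing Gram determinant \<rho> makes
    \<open>u\<close> and \<open>v\<close> collinear.\<close>
  have "(norm (\<nu> *\<^sub>R u - \<kappa> *\<^sub>R v))\<^sup>2 = \<nu> * \<rho>"
    unfolding power2_norm_eq_inner \<rho>_def
    by (simp add: inner_diff_left inner_diff_right inner_commute[of v u] power2_eq_square
        algebra_simps flip: \<kappa>_def \<mu>_def \<nu>_def)
  then have par: "\<nu> *\<^sub>R u = \<kappa> *\<^sub>R v" if "\<rho> = 0"
    using that by simp
  consider "\<rho> = 0" "\<nu> = 0" | "\<rho> = 0" "0 < \<nu>" "\<kappa> < 0" | "\<rho> = 0" "0 < \<nu>" "0 \<le> \<kappa>"
    | "0 < \<rho>" "0 < \<nu>" "\<rho> \<le> \<kappa> * \<nu>" | "0 < \<rho>" "0 < \<nu>" "\<kappa> * \<nu> < \<rho>"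
    using \<open>0 \<le> \<nu>\<close> \<open>0 \<le> \<rho>\<close> \<rho>_def by (cases "\<nu> = 0"; cases "\<rho> = 0") (force simp: not_less)+
  then show ?thesis
  proof cases
    case 1
    then have "v = 0"
      by (simp add: \<nu>_def)
    then have "z = y" "\<kappa> = 0"
      by (simp_all add: z_eq \<kappa>_def)
    have "haugazeau_Q x y z = y"
      by (rule char) (auto simp: \<open>v = 0\<close> \<nu>_def u_def)
    then show ?thesis
      unfolding unfold using 1 \<open>z = y\<close> \<open>\<kappa> = 0\<close> by simp
  next
    case 2
    have "\<not> ((w - y) \<bullet> u \<le> 0 \<and> (w - y) \<bullet> v \<le> - \<nu>)" for w
    proof
      assume w: "(w - y) \<bullet> u \<le> 0 \<and> (w - y) \<bullet> v \<le> - \<nu>"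
      \<comment> \<open>The normals point in opposite directions, so a feasible \<open>w\<close>
        would make the left side nonpositive and the right side positive.\<close>
      have "\<nu> * ((w - y) \<bullet> u) = \<kappa> * ((w - y) \<bullet> v)"
        using arg_cong[OF par[OF 2(1)], of "\<lambda>t. (w - y) \<bullet> t"] by simp
      moreover have "\<nu> * ((w - y) \<bullet> u) \<le> 0"
        using w 2 by (simp add: mult_le_0_iff)
      moreover have "0 < \<kappa> * ((w - y) \<bullet> v)"
        using w 2 by (intro mult_neg_neg) auto
      ultimately show False
        by simp
    qed
    then have "half_H x y \<inter> half_H y z = {}"
      using mem by blast
    then have "outer_O x y z = {y}"
      by (simp add: outer_O_def)
    then have "haugazeau_Q x y z = y"
      unfolding haugazeau_Q_def by (simp add: proj_onto_eqI half_H_def)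
    then show ?thesis
      by (simp add: unfold 2)
  next
    case 3
    have "haugazeau_Q x y z = z"
    proof (rule char)
      show "(z - y) \<bullet> u \<le> 0" "(z - y) \<bullet> v \<le> - \<nu>"
        using 3 by (simp_all add: z_eq \<kappa>_def \<nu>_def inner_commute)
      fix w assume w: "(w - y) \<bullet> v \<le> - \<nu>"
      have "(w - z) \<bullet> v \<le> 0"
        using w by (simp add: z_eq \<nu>_def inner_simps)
      have "\<nu> *\<^sub>R (x - z) = \<nu> *\<^sub>R u + \<nu> *\<^sub>R v"
        by (simp add: x_eq z_eq scaleR_add_right)
      then have "\<nu> *\<^sub>R (x - z) = (\<kappa> + \<nu>) *\<^sub>R v"
        by (simp add: par[OF 3(1)] scaleR_add_left)
      then have "\<nu> * ((w - z) \<bullet> (x - z)) = (\<kappa> + \<nu>) * ((w - z) \<bullet> v)"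
        by (metis inner_scaleR_right)
      also have "\<dots> \<le> 0"
        using 3 \<open>(w - z) \<bullet> v \<le> 0\<close> by (intro mult_nonneg_nonpos) auto
      finally show "(w - z) \<bullet> (x - z) \<le> 0"
        using 3 by (simp add: mult_le_0_iff)
    qed
    then show ?thesis
      using 3 by (simp add: unfold)
  next
    case 4
    then have "0 < \<kappa>"
      by (metis order_less_le_trans zero_less_mult_pos2)
    \<comment> \<open>The projection of \<open>x\<close> onto \<open>half_H y z\<close> alone;
      \<open>\<rho> \<le> \<kappa> * \<nu>\<close> says exactly that it also lies in
      \<open>half_H x y\<close>.\<close>
    define p where "p = x - (1 + \<kappa> / \<nu>) *\<^sub>R v"
    have p: "p - y = u - (1 + \<kappa> / \<nu>) *\<^sub>R v" "x - p = (1 + \<kappa> / \<nu>) *\<^sub>R v"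
      by (simp_all add: p_def u_def)
    have pv: "(p - y) \<bullet> v = - \<nu>"
      using 4 unfolding p by (simp add: inner_simps flip: \<kappa>_def \<nu>_def) (simp add: field_simps)
    have "(p - y) \<bullet> u = \<mu> - (1 + \<kappa> / \<nu>) * \<kappa>"
      unfolding p by (simp add: inner_simps inner_commute \<kappa>_def \<mu>_def)
    also have "\<dots> = (\<rho> - \<kappa> * \<nu>) / \<nu>"
      using 4 by (simp add: \<rho>_def field_simps power2_eq_square)
    also have "\<dots> \<le> 0"
      using 4 by (simp add: divide_le_0_iff)
    finally have pu: "(p - y) \<bullet> u \<le> 0" .
    have "haugazeau_Q x y z = p"
    proof (rule char[OF pu])
      show "(p - y) \<bullet> v \<le> - \<nu>"
        by (simp add: pv)
      fix w assume "(w - y) \<bullet> v \<le> - \<nu>"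
      then have "(w - p) \<bullet> v \<le> 0"
        using pv by (simp add: inner_simps)
      then show "(w - p) \<bullet> (x - p) \<le> 0"
        using 4 \<open>0 < \<kappa>\<close> unfolding p(2) by (simp add: mult_nonneg_nonpos)
    qed
    then show ?thesis
      using 4 by (simp add: unfold p_def)
  next
    case 5
    \<comment> \<open>Both constraints are active here. The case condition makes the multiplier of
      \<open>u\<close> in \<open>x - p\<close> nonnegative.\<close>
    define p where "p = y + (\<nu> / \<rho>) *\<^sub>R (\<kappa> *\<^sub>R u - \<mu> *\<^sub>R v)"
    have p: "p - y = (\<nu> / \<rho>) *\<^sub>R (\<kappa> *\<^sub>R u - \<mu> *\<^sub>R v)"
      by (simp add: p_def)
    have pu: "(p - y) \<bullet> u = 0"
      unfolding p by (simp add: inner_simps inner_commute[of v u] flip: \<kappa>_def \<mu>_def)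
    have "(p - y) \<bullet> v = (\<nu> / \<rho>) * (\<kappa> * \<kappa> - \<mu> * \<nu>)"
      unfolding p by (simp add: inner_simps flip: \<kappa>_def \<nu>_def)
    also have "\<kappa> * \<kappa> - \<mu> * \<nu> = - \<rho>"
      by (simp add: \<rho>_def power2_eq_square)
    finally have pv: "(p - y) \<bullet> v = - \<nu>"
      using 5 by simp
    have "x - p = u - (p - y)"
      by (simp add: u_def)
    then have xp: "x - p = (1 - \<kappa> * \<nu> / \<rho>) *\<^sub>R u + (\<nu> * \<mu> / \<rho>) *\<^sub>R v"
      unfolding p by (simp add: algebra_simps)
    have "haugazeau_Q x y z = p"
    proof (rule char)
      show "(p - y) \<bullet> u \<le> 0" "(p - y) \<bullet> v \<le> - \<nu>"
        by (simp_all add: pu pv)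
      fix w assume "(w - y) \<bullet> u \<le> 0" "(w - y) \<bullet> v \<le> - \<nu>"
      then have "(w - p) \<bullet> u \<le> 0" "(w - p) \<bullet> v \<le> 0"
        using pu pv by (simp_all add: inner_simps)
      moreover have "0 \<le> 1 - \<kappa> * \<nu> / \<rho>" "0 \<le> \<nu> * \<mu> / \<rho>"
        using 5 \<open>0 \<le> \<mu>\<close> by (simp_all add: field_simps)
      ultimately have "(1 - \<kappa> * \<nu> / \<rho>) * ((w - p) \<bullet> u) + (\<nu> * \<mu> / \<rho>) * ((w - p) \<bullet> v) \<le> 0"
        by (intro add_nonpos_nonpos mult_nonneg_nonpos)
      then show "(w - p) \<bullet> (x - p) \<le> 0"
        unfolding xp by (simp add: inner_add_right)
    qed
    then show ?thesis
      using 5 by (simp add: unfold p_def)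
  qed
qed

lemma borel_measurable_haugazeau_Q:
  fixes f g h :: "'w \<Rightarrow> 'a::{real_inner, complete_space, second_countable_topology}"
  assumes [measurable]: "f \<in> borel_measurable M" "g \<in> borel_measurable M" "h \<in> borel_measurable M"
  shows "(\<lambda>\<omega>. haugazeau_Q (f \<omega>) (g \<omega>) (h \<omega>)) \<in> borel_measurable M"
  unfolding haugazeau_Q_eq haugazeau_point_def Let_def by measurable

text \<open>The defining inner product equals \<open>t\<close> times the one for \<open>a\<close>,
  minus \<open>t * (1 - t)\<close> times a square: stopping short of \<open>a\<close> only enlarges
  the half-space.\<close>

lemma half_H_relaxation:
  assumes "w \<in> half_H x a" "0 \<le> t" "t \<le> 1"
  shows "w \<in> half_H x (x + t *\<^sub>R (a - x))"
proof -
  have "(w - (x + t *\<^sub>R (a - x))) \<bullet> (x - (x + t *\<^sub>R (a - x))) =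
      t * ((w - a) \<bullet> (x - a)) - t * (1 - t) * ((x - a) \<bullet> (x - a))"
    by (simp add: inner_simps inner_commute algebra_simps)
  also have "\<dots> \<le> 0"
    using assms by (auto simp: half_H_def intro!: order_trans[OF mult_nonneg_nonpos])
  finally show ?thesis
    by (simp add: half_H_def)
qed

text \<open>A nonempty \<open>Z\<close> rules out the singleton branch of \<open>outer_O\<close>, so
  the operator truly projects onto the intersection. The last claim is the variational inequality
  restricted to \<open>Z\<close>.\<close>

lemma haugazeau_Q_mem:
  fixes x y z :: "'a::{real_inner, complete_space}"
  assumes "Z \<noteq> {}" "Z \<subseteq> half_H x y \<inter> half_H y z"
  shows "haugazeau_Q x y z \<in> half_H x y" "haugazeau_Q x y z \<in> half_H y z"
    "Z \<subseteq> half_H x (haugazeau_Q x y z)"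
proof -
  have O: "outer_O x y z = half_H x y \<inter> half_H y z"
    using assms by (auto simp: outer_O_def)
  have "haugazeau_Q x y z \<in> outer_O x y z \<and> outer_O x y z \<subseteq> half_H x (haugazeau_Q x y z)"
    unfolding haugazeau_Q_def
    using nearest_point_proj_onto[OF outer_O_closed_convex, of x y z x]
    by (simp add: nearest_point_iff_half_H outer_O_closed_convex)
  then show "haugazeau_Q x y z \<in> half_H x y" "haugazeau_Q x y z \<in> half_H y z"
    "Z \<subseteq> half_H x (haugazeau_Q x y z)"
    using assms(2) unfolding O by blast+
qed

subsection \<open>Deterministic Haugazeau sequences\<close>

text \<open>A single path on which all the almost sure hypotheses hold simultaneously.\<close>

locale haugazeau_sequence =
  fixes Z :: "'a::{real_inner, complete_space} set"
    and x a r :: "nat \<Rightarrow> 'a" and lam :: "nat \<Rightarrow> real"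
  assumes Z: "Z \<noteq> {}" "closed Z" "convex Z"
    and cut: "\<And>n. Z \<subseteq> half_H (x n) (a n)"
    and lam: "\<And>n. 0 < lam n" "\<And>n. lam n \<le> 1"
    and r_eq: "\<And>n. r n = x n + lam n *\<^sub>R (a n - x n)"
    and x_Suc: "\<And>n. x (Suc n) = haugazeau_Q (x 0) (x n) (r n)"
begin

lemma Z_subset_half_H_r: "Z \<subseteq> half_H (x n) (r n)"
  unfolding r_eq using cut lam by (blast intro: half_H_relaxation less_imp_le)

text \<open>Induction: the start is trivial because \<open>half_H (x 0) (x 0)\<close> is the whole
  space, and projecting onto an intersection that contains \<open>Z\<close> reproduces the inclusion
  at the next iterate.\<close>

lemma Z_subset_half_H_x: "Z \<subseteq> half_H (x 0) (x n)"
proof (induction n)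
  case 0
  then show ?case
    by (simp add: half_H_def)
next
  case (Suc n)
  then show ?case
    unfolding x_Suc using Z(1) Z_subset_half_H_r by (intro haugazeau_Q_mem) auto
qed

lemma x_Suc_mem: "x (Suc n) \<in> half_H (x 0) (x n)" "x (Suc n) \<in> half_H (x n) (r n)"
proof -
  have "Z \<subseteq> half_H (x 0) (x n) \<inter> half_H (x n) (r n)"
    using Z_subset_half_H_r Z_subset_half_H_x by blast
  then show "x (Suc n) \<in> half_H (x 0) (x n)" "x (Suc n) \<in> half_H (x n) (r n)"
    unfolding x_Suc using Z(1) by (blast intro: haugazeau_Q_mem)+
qed

lemma step_le_increment:
  "(norm (x (Suc n) - x n))\<^sup>2 \<le> (norm (x (Suc n) - x 0))\<^sup>2 - (norm (x n - x 0))\<^sup>2"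
  using half_H_pythagoras[OF x_Suc_mem(1)[of n]] by simp

text \<open>\<open>r n\<close> is the point of \<open>half_H (x n) (r n)\<close> nearest to
  \<open>x n\<close>, and \<open>x (Suc n)\<close> lies in that half-space.\<close>

lemma relaxation_step_le: "(lam n)\<^sup>2 * (norm (a n - x n))\<^sup>2 \<le> (norm (x (Suc n) - x n))\<^sup>2"
proof -
  have "(lam n)\<^sup>2 * (norm (a n - x n))\<^sup>2 = (norm (r n - x n))\<^sup>2"
    by (simp add: r_eq power_mult_distrib)
  then show ?thesis
    using half_H_pythagoras[OF x_Suc_mem(2)[of n]] zero_le_power2[of "norm (x (Suc n) - r n)"]
    by linarith
qed

lemma dist_Z_le:
  assumes "w \<in> Z"
  shows "(norm (w - x n))\<^sup>2 + (norm (x n - x 0))\<^sup>2 \<le> (norm (w - x 0))\<^sup>2"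
  using Z_subset_half_H_x assms by (blast intro: half_H_pythagoras)

lemma norm_le_dist_Z:
  assumes "w \<in> Z"
  shows "norm (x n - x 0) \<le> norm (w - x 0)" "norm (w - x n) \<le> norm (w - x 0)"
proof -
  have "(norm (x n - x 0))\<^sup>2 \<le> (norm (w - x 0))\<^sup>2" "(norm (w - x n))\<^sup>2 \<le> (norm (w - x 0))\<^sup>2"
    using dist_Z_le[OF assms, of n] zero_le_power2[of "norm (x n - x 0)"]
      zero_le_power2[of "norm (w - x n)"] by linarith+
  then show "norm (x n - x 0) \<le> norm (w - x 0)" "norm (w - x n) \<le> norm (w - x 0)"
    by (auto intro: power2_le_imp_le)
qed

lemma incseq_norm: "incseq (\<lambda>n. norm (x n - x 0))"
proof (rule incseq_SucI)
  fix n
  have "(norm (x n - x 0))\<^sup>2 \<le> (norm (x (Suc n) - x 0))\<^sup>2"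
    using step_le_increment[of n] zero_le_power2[of "norm (x (Suc n) - x n)"] by linarith
  then show "norm (x n - x 0) \<le> norm (x (Suc n) - x 0)"
    by (auto intro: power2_le_imp_le)
qed

lemma sum_steps_le:
  assumes "w \<in> Z"
  shows "(\<Sum>n<N. (norm (x (Suc n) - x n))\<^sup>2) \<le> (norm (w - x 0))\<^sup>2"
proof -
  have "(\<Sum>n<N. (norm (x (Suc n) - x n))\<^sup>2)
      \<le> (\<Sum>n<N. (norm (x (Suc n) - x 0))\<^sup>2 - (norm (x n - x 0))\<^sup>2)"
    by (intro sum_mono step_le_increment)
  also have "\<dots> = (norm (x N - x 0))\<^sup>2"
    by (subst sum_lessThan_telescope) simp
  also have "\<dots> \<le> (norm (w - x 0))\<^sup>2"
    using norm_le_dist_Z[OF assms] by (intro power_mono) auto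
  finally show ?thesis .
qed

lemma proj_in_Z: "proj_onto Z (x 0) \<in> Z"
  using nearest_point_proj_onto[OF Z] by (auto simp: nearest_point_def)

lemma convergent_norm: "convergent (\<lambda>n. norm (x n - x 0))"
  using incseq_convergent[OF incseq_norm] norm_le_dist_Z(1)[OF proj_in_Z]
  unfolding convergent_def by blast

lemma bounded_x: "bounded (range x)"
proof (rule boundedI)
  fix y assume "y \<in> range x"
  then obtain n where "y = x n"
    by blast
  then show "norm y \<le> norm (x 0) + norm (proj_onto Z (x 0) - x 0)"
    using norm_le_dist_Z(1)[OF proj_in_Z, of n] norm_triangle_sub[of "x n" "x 0"] by simp
qed

lemma strongly_convergent:
  assumes k: "strict_mono k" and weak: "weakly_converges (x \<circ> k) w" and "w \<in> Z"
  shows "x \<longlonglongrightarrow> proj_onto Z (x 0)"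
proof -
  define p N where "p = proj_onto Z (x 0)" and "N = norm (p - x 0)"
  have "p \<in> Z"
    by (simp add: p_def proj_in_Z)
  have le_N: "norm (x n - x 0) \<le> N" for n
    unfolding N_def by (rule norm_le_dist_Z(1)[OF \<open>p \<in> Z\<close>])
  have lim: "(\<lambda>i. (x (k i) - x 0) \<bullet> u) \<longlonglongrightarrow> (w - x 0) \<bullet> u" for u
    unfolding inner_diff_left using weak
    by (intro tendsto_diff tendsto_const) (simp add: weakly_converges_def)
  \<comment> \<open>Weak lower semicontinuity of the norm, obtained by testing the weak limit
    against \<open>w - x 0\<close> itself. It makes \<open>w\<close> another nearest point of
    \<open>Z\<close>, so \<open>w = p\<close> by uniqueness.\<close>
  have "norm (w - x 0) * norm (w - x 0) \<le> N * norm (w - x 0)"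
  proof -
    have "(x (k i) - x 0) \<bullet> (w - x 0) \<le> N * norm (w - x 0)" for i
      using norm_cauchy_schwarz[of "x (k i) - x 0" "w - x 0"] le_N[of "k i"]
      by (meson mult_right_mono norm_ge_zero order_trans)
    then show ?thesis
      using LIMSEQ_le_const2[OF lim[of "w - x 0"]]
      by (simp add: power2_norm_eq_inner flip: power2_eq_square)
  qed
  then have w_le: "norm (w - x 0) \<le> N"
    using N_def by (metis mult_le_cancel_right_pos norm_ge_zero less_eq_real_def)
  have nearest: "nearest_point Z (x 0) p"
    unfolding p_def by (rule nearest_point_proj_onto[OF Z])
  then have "nearest_point Z (x 0) w"
    using w_le \<open>w \<in> Z\<close> unfolding nearest_point_def N_def
    by (metis norm_minus_commute order_trans)
  then have "w = p"
    using ex1_nearest_point[OF Z] nearest by blast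
  obtain l where l: "(\<lambda>n. norm (x n - x 0)) \<longlonglongrightarrow> l"
    using convergent_norm convergent_def by blast
  then have lk: "(\<lambda>i. norm (x (k i) - x 0)) \<longlonglongrightarrow> l"
    using LIMSEQ_subseq_LIMSEQ[OF l k] by (simp add: o_def)
  have "l \<le> N" "0 \<le> l"
    using l le_N by (auto intro: LIMSEQ_le_const2 LIMSEQ_le_const)
  \<comment> \<open>Testing against \<open>p - x 0\<close> gives the reverse bound
    \<open>N \<le> l\<close> when \<open>N\<close> is nonzero; for \<open>N = 0\<close> the bounds
    on \<open>l\<close> already suffice.\<close>
  have "(\<lambda>i. (x (k i) - x 0) \<bullet> (p - x 0)) \<longlonglongrightarrow> N * N"
    using lim[of "p - x 0"] \<open>w = p\<close> by (simp add: N_def power2_norm_eq_inner flip: power2_eq_square)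
  moreover have "(\<lambda>i. norm (x (k i) - x 0) * N) \<longlonglongrightarrow> l * N"
    by (intro tendsto_intros lk)
  ultimately have "N * N \<le> l * N"
    by (rule LIMSEQ_le) (auto simp: N_def norm_cauchy_schwarz)
  then have "l = N"
    using \<open>l \<le> N\<close> \<open>0 \<le> l\<close> by (cases "N = 0") (auto simp: mult_le_cancel_right)
  have "(\<lambda>n. N\<^sup>2 - (norm (x n - x 0))\<^sup>2) \<longlonglongrightarrow> N\<^sup>2 - l\<^sup>2"
    by (intro tendsto_intros l)
  then have "(\<lambda>n. N\<^sup>2 - (norm (x n - x 0))\<^sup>2) \<longlonglongrightarrow> 0"
    by (simp add: \<open>l = N\<close>)
  then have "(\<lambda>n. (norm (p - x n))\<^sup>2) \<longlonglongrightarrow> 0"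
  proof (rule tendsto_sandwich[OF _ _ tendsto_const, rotated 2])
    show "\<forall>\<^sub>F n in sequentially. (norm (p - x n))\<^sup>2 \<le> N\<^sup>2 - (norm (x n - x 0))\<^sup>2"
      using dist_Z_le[OF \<open>p \<in> Z\<close>] by (simp add: N_def algebra_simps)
  qed simp
  then have "(\<lambda>n. norm (p - x n)) \<longlonglongrightarrow> 0"
    using tendsto_real_sqrt by fastforce
  then have "(\<lambda>n. dist (x n) p) \<longlonglongrightarrow> 0"
    by (simp add: dist_norm norm_minus_commute)
  then show ?thesis
    unfolding p_def by (rule tendsto_dist_iff[THEN iffD2])
qed

end

subsection \<open>Random sequences\<close>

lemma L2_mono:
  assumes "g \<in> L2 M" "f \<in> borel_measurable M" "AE \<omega> in M. norm (f \<omega>) \<le> norm (g \<omega>)"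
  shows "f \<in> L2 M"
proof -
  have "integrable M (\<lambda>\<omega>. (norm (f \<omega>))\<^sup>2)"
  proof (rule Bochner_Integration.integrable_bound)
    show "integrable M (\<lambda>\<omega>. (norm (g \<omega>))\<^sup>2)"
      using assms by (simp add: L2_def)
    show "(\<lambda>\<omega>. (norm (f \<omega>))\<^sup>2) \<in> borel_measurable M"
      using assms(2) by measurable
    show "AE \<omega> in M. norm ((norm (f \<omega>))\<^sup>2) \<le> norm ((norm (g \<omega>))\<^sup>2)"
      using assms(3) by eventually_elim (simp add: power_mono)
  qed
  then show ?thesis
    using assms by (simp add: L2_def)
qed

lemma L2_diff:
  fixes f g :: "'w \<Rightarrow> 'a::{real_inner, second_countable_topology}"
  assumes "f \<in> L2 M" "g \<in> L2 M"
  shows "(\<lambda>\<omega>. f \<omega> - g \<omega>) \<in> L2 M"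
proof -
  have [measurable]: "f \<in> borel_measurable M" "g \<in> borel_measurable M"
    using assms by (auto simp: L2_def)
  have "integrable M (\<lambda>\<omega>. (norm (f \<omega> - g \<omega>))\<^sup>2)"
  proof (rule Bochner_Integration.integrable_bound)
    show "integrable M (\<lambda>\<omega>. 2 * (norm (f \<omega>))\<^sup>2 + 2 * (norm (g \<omega>))\<^sup>2)"
      using assms by (simp add: L2_def)
    have "(norm (u - v))\<^sup>2 \<le> 2 * (norm u)\<^sup>2 + 2 * (norm v)\<^sup>2" for u v :: 'a
      using zero_le_power2[of "norm (u + v)"]
      by (simp add: power2_norm_eq_inner inner_simps inner_commute)
    then show "AE \<omega> in M. norm ((norm (f \<omega> - g \<omega>))\<^sup>2)
        \<le> norm (2 * (norm (f \<omega>))\<^sup>2 + 2 * (norm (g \<omega>))\<^sup>2)"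
      by simp
  qed measurable
  then show ?thesis
    by (simp add: L2_def)
qed

text \<open>Completeness absorbs changes on null sets. This is needed because the recursions for
  \<open>r\<close> and \<open>x\<close> hold only almost surely.\<close>

lemma (in complete_measure) measurable_AE_eq:
  assumes f: "f \<in> borel_measurable M" and eq: "AE \<omega> in M. g \<omega> = f \<omega>"
  shows "g \<in> borel_measurable M"
proof (rule measurableI)
  fix A :: "'b set" assume "A \<in> sets borel"
  then have "f -` A \<inter> space M \<in> sets M"
    using f by (rule measurable_sets[rotated])
  then show "g -` A \<inter> space M \<in> sets M"
    by (rule in_sets_AE[rotated]) (use eq in \<open>auto elim: eventually_mono\<close>)
qed simp

section \<open>Series of expectations and conditional expectations\<close>

text \<open>Monotone convergence exchanges sum and integral, and the uniform bound on partial sums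
  passes to the series.\<close>

lemma suminf_nn_integral_finite:
  fixes f :: "nat \<Rightarrow> 'w \<Rightarrow> real"
  assumes [measurable]: "\<And>n. f n \<in> borel_measurable M" and nonneg: "\<And>n \<omega>. 0 \<le> f n \<omega>"
    and g: "integrable M g" and bound: "AE \<omega> in M. \<forall>N. (\<Sum>n<N. f n \<omega>) \<le> g \<omega>"
  shows "(\<Sum>n. \<integral>\<^sup>+\<omega>. ennreal (f n \<omega>) \<partial>M) < \<infinity>"
proof -
  have "(\<Sum>n. \<integral>\<^sup>+\<omega>. ennreal (f n \<omega>) \<partial>M) = (\<integral>\<^sup>+\<omega>. (\<Sum>n. ennreal (f n \<omega>)) \<partial>M)"
    by (rule nn_integral_suminf[symmetric]) simp
  also have "\<dots> \<le> (\<integral>\<^sup>+\<omega>. ennreal (g \<omega>) \<partial>M)"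
    using bound
  proof (intro nn_integral_mono_AE, eventually_elim)
    fix \<omega> assume "\<forall>N. (\<Sum>n<N. f n \<omega>) \<le> g \<omega>"
    then show "(\<Sum>n. ennreal (f n \<omega>)) \<le> ennreal (g \<omega>)"
      using nonneg by (intro suminf_le_const summableI) (simp add: sum_ennreal ennreal_leI)
  qed
  also have "\<dots> \<le> (\<integral>\<^sup>+\<omega>. ennreal (norm (g \<omega>)) \<partial>M)"
    by (intro nn_integral_mono ennreal_leI) simp
  also have "\<dots> < \<infinity>"
    using g by (simp add: integrable_iff_bounded)
  finally show ?thesis .
qed

text \<open>Conditioning preserves expectations, so the series of conditional expectations has
  finite integral and is therefore finite almost everywhere.\<close>

lemma AE_suminf_nn_cond_exp_finite:
  assumes sub: "\<And>n. sigma_finite_subalgebra M (F n)"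
    and f [measurable]: "\<And>n. f n \<in> borel_measurable M"
    and fin: "(\<Sum>n. \<integral>\<^sup>+\<omega>. f n \<omega> \<partial>M) < \<infinity>"
  shows "AE \<omega> in M. (\<Sum>n. nn_cond_exp M (F n) (f n) \<omega>) < \<infinity>"
proof -
  have eq: "(\<integral>\<^sup>+\<omega>. nn_cond_exp M (F n) (f n) \<omega> \<partial>M) = (\<integral>\<^sup>+\<omega>. f n \<omega> \<partial>M)" for n
    using sigma_finite_subalgebra.nn_cond_exp_intg[OF sub, of "\<lambda>_. 1" n "f n"] by simp
  have [measurable]: "nn_cond_exp M (F n) (f n) \<in> borel_measurable M" for n
    by simp
  have "(\<integral>\<^sup>+\<omega>. (\<Sum>n. nn_cond_exp M (F n) (f n) \<omega>) \<partial>M) < \<infinity>"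
    by (subst nn_integral_suminf) (simp_all add: eq fin[simplified])
  then have "AE \<omega> in M. (\<Sum>n. nn_cond_exp M (F n) (f n) \<omega>) \<noteq> \<infinity>"
    by (intro nn_integral_PInf_AE) auto
  then show ?thesis
    by eventually_elim (simp add: less_top)
qed

lemma subalgebra_generated_sigma:
  assumes "\<And>i. x i \<in> borel_measurable M"
  shows "subalgebra M (generated_sigma M x n)"
proof -
  let ?G = "{x i -` A \<inter> space M |i A. i \<le> n \<and> A \<in> sets borel}"
  have "?G \<subseteq> sets M"
    using assms by (auto intro: measurable_sets)
  then have "sigma_sets (space M) ?G \<subseteq> sets M"
    by (rule sets.sigma_sets_subset)
  moreover have "?G \<subseteq> Pow (space M)"
    by blast
  ultimately show ?thesis
    unfolding subalgebra_def generated_sigma_def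
    by (simp add: sets_measure_of space_measure_of)
qed

section \<open>From individual paths to random sequences\<close>

theorem theorem3p1:
  fixes M :: "'w measure"
    and Z :: "'h::{real_inner, complete_space, second_countable_topology} set"
    and x a r :: "nat \<Rightarrow> 'w \<Rightarrow> 'h"
    and lam :: "nat \<Rightarrow> 'w \<Rightarrow> real"
  assumes "prob_space M" and "complete_measure M"
    and "Z \<noteq> {}" and "closed Z" and "convex Z"
    and "x 0 \<in> L2 M"
    and "\<And>n. a n \<in> L2 M"
    and "\<And>n. AE \<omega> in M. Z \<subseteq> half_H (x n \<omega>) (a n \<omega>)"
    and "\<And>n. lam n \<in> Linfty M {0<..1}"
    and "\<And>n. AE \<omega> in M. r n \<omega> = x n \<omega> + lam n \<omega> *\<^sub>R (a n \<omega> - x n \<omega>)"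
    and "\<And>n. AE \<omega> in M. x (Suc n) \<omega> = haugazeau_Q (x 0 \<omega>) (x n \<omega>) (r n \<omega>)"
  shows
    "((\<forall>n. \<forall>\<omega>\<in>space M.
          \<exists>!p. nearest_point (outer_O (x 0 \<omega>) (x n \<omega>) (r n \<omega>)) (x 0 \<omega>) p) \<and>
      (\<forall>n. x n \<in> L2 M)) \<and>
     (\<forall>n. AE \<omega> in M. Z \<subseteq> half_H (x 0 \<omega>) (x n \<omega>) \<inter> half_H (x n \<omega>) (r n \<omega>)) \<and>
     (\<exists>l::'w \<Rightarrow> real. l \<in> L2 M \<and>
       (AE \<omega> in M. incseq (\<lambda>n. norm (x n \<omega> - x 0 \<omega>)) \<and>
          (\<lambda>n. norm (x n \<omega> - x 0 \<omega>)) \<longlonglongrightarrow> l \<omega> \<and>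
          l \<omega> \<le> norm (proj_onto Z (x 0 \<omega>) - x 0 \<omega>))) \<and>
     (AE \<omega> in M. bounded (range (\<lambda>n. norm (x n \<omega>)))) \<and>
     ((\<Sum>n. \<integral>\<^sup>+\<omega>. ennreal ((norm (x (Suc n) \<omega> - x n \<omega>))\<^sup>2) \<partial>M) < \<infinity> \<and>
      (AE \<omega> in M. (\<Sum>n. nn_cond_exp M (generated_sigma M x n)
         (\<lambda>\<omega>'. ennreal ((norm (x (Suc n) \<omega>' - x n \<omega>'))\<^sup>2)) \<omega>) < \<infinity>)) \<and>
     ((\<Sum>n. \<integral>\<^sup>+\<omega>. ennreal ((lam n \<omega>)\<^sup>2 * (norm (a n \<omega> - x n \<omega>))\<^sup>2) \<partial>M) < \<infinity> \<and>
      (AE \<omega> in M. (\<Sum>n. nn_cond_exp M (generated_sigma M x n)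
         (\<lambda>\<omega>'. ennreal ((lam n \<omega>')\<^sup>2 * (norm (a n \<omega>' - x n \<omega>'))\<^sup>2)) \<omega>) < \<infinity>)) \<and>
     ((AE \<omega> in M. weak_cluster_points (\<lambda>n. x n \<omega>) \<subseteq> Z) \<longrightarrow>
       (AE \<omega> in M. (\<lambda>n. x n \<omega>) \<longlonglongrightarrow> proj_onto Z (x 0 \<omega>)) \<and>
       converges_in_L2 M x (\<lambda>\<omega>. proj_onto Z (x 0 \<omega>)))"
proof -
  interpret prob_space M by fact
  interpret complete_measure M by fact
  note Z = \<open>Z \<noteq> {}\<close> \<open>closed Z\<close> \<open>convex Z\<close>
  obtain z where "z \<in> Z"
    using Z by blast
  let ?S = "\<lambda>\<omega>. haugazeau_sequence Z (\<lambda>n. x n \<omega>) (\<lambda>n. a n \<omega>) (\<lambda>n. r n \<omega>) (\<lambda>n. lam n \<omega>)"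
  let ?p = "\<lambda>\<omega>. proj_onto Z (x 0 \<omega>)"
  have seq: "AE \<omega> in M. ?S \<omega>"
  proof -
    have "AE \<omega> in M. lam n \<omega> \<in> {0<..1}" for n
      using assms(9)[of n] by (simp add: Linfty_def)
    \<comment> \<open>Countably many null sets are merged, so that one exceptional set serves all
      indices.\<close>
    then have "AE \<omega> in M. \<forall>n. Z \<subseteq> half_H (x n \<omega>) (a n \<omega>) \<and> lam n \<omega> \<in> {0<..1} \<and>
        r n \<omega> = x n \<omega> + lam n \<omega> *\<^sub>R (a n \<omega> - x n \<omega>) \<and>
        x (Suc n) \<omega> = haugazeau_Q (x 0 \<omega>) (x n \<omega>) (r n \<omega>)"
      using assms(8,10,11) unfolding AE_all_countable by (intro allI AE_conjI)
    then show ?thesis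
      by eventually_elim (use Z in \<open>unfold_locales; auto\<close>)
  qed
  have a_meas [measurable]: "a n \<in> borel_measurable M" for n
    using assms(7) by (simp add: L2_def)
  have lam_meas [measurable]: "lam n \<in> borel_measurable M" for n
    using assms(9) by (simp add: Linfty_def)
  have x_meas [measurable]: "x n \<in> borel_measurable M" for n
  proof (induction n)
    case 0
    then show ?case
      using assms(6) by (simp add: L2_def)
  next
    case (Suc n)
    have [measurable]: "x 0 \<in> borel_measurable M"
      using assms(6) by (simp add: L2_def)
    note Suc [measurable]
    have "r n \<in> borel_measurable M"
      by (rule measurable_AE_eq[OF _ assms(10)]) measurable
    then show ?case
      by (intro measurable_AE_eq[OF _ assms(11)] borel_measurable_haugazeau_Q Suc) simp_all
  qed
  have p_meas [measurable]: "?p \<in> borel_measurable M"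
    using borel_measurable_continuous_onI[OF continuous_on_proj_onto[OF Z]]
    by (rule measurable_compose[rotated]) simp
  \<comment> \<open>The distance to one fixed point of \<open>Z\<close> dominates the displacements
    of all iterates, of the projection and of the limit \<open>l\<close>. The constant
    \<open>z\<close> is square integrable because the measure is finite.\<close>
  have z_L2: "(\<lambda>\<omega>. z - x 0 \<omega>) \<in> L2 M"
    using assms(6) by (intro L2_diff) (simp_all add: L2_def)
  have L2_trans: "f \<in> L2 M" if "(\<lambda>\<omega>. x 0 \<omega> - f \<omega>) \<in> L2 M" for f
    using L2_diff[OF assms(6) that] by simp
  have x_L2: "x n \<in> L2 M" for n
  proof (rule L2_trans, rule L2_mono[OF z_L2])
    show "AE \<omega> in M. norm (x 0 \<omega> - x n \<omega>) \<le> norm (z - x 0 \<omega>)"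
      using seq
    proof eventually_elim
      case (elim \<omega>)
      then show ?case
        using haugazeau_sequence.norm_le_dist_Z(1)[OF elim \<open>z \<in> Z\<close>, of n]
        by (simp add: norm_minus_commute)
    qed
  qed measurable
  have p_L2: "?p \<in> L2 M"
    by (rule L2_trans, rule L2_mono[OF z_L2])
      (use nearest_point_proj_onto[OF Z] \<open>z \<in> Z\<close> in
        \<open>auto simp: nearest_point_def norm_minus_commute[of z]\<close>)
  have steps: "(\<Sum>n. \<integral>\<^sup>+\<omega>. ennreal ((norm (x (Suc n) \<omega> - x n \<omega>))\<^sup>2) \<partial>M) < \<infinity>"
  proof (rule suminf_nn_integral_finite)
    show "integrable M (\<lambda>\<omega>. (norm (z - x 0 \<omega>))\<^sup>2)"
      using z_L2 by (simp add: L2_def)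
    show "AE \<omega> in M. \<forall>N. (\<Sum>n<N. (norm (x (Suc n) \<omega> - x n \<omega>))\<^sup>2) \<le> (norm (z - x 0 \<omega>))\<^sup>2"
      using seq by eventually_elim (auto intro: haugazeau_sequence.sum_steps_le[OF _ \<open>z \<in> Z\<close>])
  qed auto
  have "(\<Sum>n. \<integral>\<^sup>+\<omega>. ennreal ((lam n \<omega>)\<^sup>2 * (norm (a n \<omega> - x n \<omega>))\<^sup>2) \<partial>M)
      \<le> (\<Sum>n. \<integral>\<^sup>+\<omega>. ennreal ((norm (x (Suc n) \<omega> - x n \<omega>))\<^sup>2) \<partial>M)"
  proof (intro suminf_le summableI nn_integral_mono_AE)
    show "AE \<omega> in M. ennreal ((lam n \<omega>)\<^sup>2 * (norm (a n \<omega> - x n \<omega>))\<^sup>2)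
        \<le> ennreal ((norm (x (Suc n) \<omega> - x n \<omega>))\<^sup>2)" for n
      using seq by eventually_elim (intro ennreal_leI haugazeau_sequence.relaxation_step_le)
  qed
  then have relaxations:
    "(\<Sum>n. \<integral>\<^sup>+\<omega>. ennreal ((lam n \<omega>)\<^sup>2 * (norm (a n \<omega> - x n \<omega>))\<^sup>2) \<partial>M) < \<infinity>"
    using steps by (rule order_le_less_trans)
  have subalg: "sigma_finite_subalgebra M (generated_sigma M x n)" for n
    by (intro finite_measure_subalgebra_is_sigma_finite finite_measure_subalgebra.intro
        finite_measure_subalgebra_axioms.intro subalgebra_generated_sigma x_meas)
      unfold_locales
  have i: "(\<forall>n. \<forall>\<omega>\<in>space M.
      \<exists>!p. nearest_point (outer_O (x 0 \<omega>) (x n \<omega>) (r n \<omega>)) (x 0 \<omega>) p) \<and> (\<forall>n. x n \<in> L2 M)"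
    using x_L2 by (intro conjI allI ballI ex1_nearest_point outer_O_closed_convex)
  have ii: "\<forall>n. AE \<omega> in M. Z \<subseteq> half_H (x 0 \<omega>) (x n \<omega>) \<inter> half_H (x n \<omega>) (r n \<omega>)"
  proof
    show "AE \<omega> in M. Z \<subseteq> half_H (x 0 \<omega>) (x n \<omega>) \<inter> half_H (x n \<omega>) (r n \<omega>)" for n
      using seq
    proof eventually_elim
      case (elim \<omega>)
      then show ?case
        using haugazeau_sequence.Z_subset_half_H_r[OF elim]
          haugazeau_sequence.Z_subset_half_H_x[OF elim] by blast
    qed
  qed
  have iii: "\<exists>l::'w \<Rightarrow> real. l \<in> L2 M \<and>
       (AE \<omega> in M. incseq (\<lambda>n. norm (x n \<omega> - x 0 \<omega>)) \<and>
          (\<lambda>n. norm (x n \<omega> - x 0 \<omega>)) \<longlonglongrightarrow> l \<omega> \<and>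
          l \<omega> \<le> norm (?p \<omega> - x 0 \<omega>))"
  proof (intro exI conjI)
    \<comment> \<open>On divergent paths \<open>lim\<close> takes a default value; \<open>l\<close>
      is nevertheless measurable, and its bounds are claimed only almost surely.\<close>
    define l where "l \<omega> = lim (\<lambda>n. norm (x n \<omega> - x 0 \<omega>))" for \<omega>
    have lim: "(\<lambda>n. norm (x n \<omega> - x 0 \<omega>)) \<longlonglongrightarrow> l \<omega>" if "?S \<omega>" for \<omega>
      unfolding l_def using haugazeau_sequence.convergent_norm[OF that]
      by (rule convergent_LIMSEQ_iff[THEN iffD1])
    have le: "l \<omega> \<le> norm (w - x 0 \<omega>)" if "?S \<omega>" "w \<in> Z" for \<omega> w
      using haugazeau_sequence.norm_le_dist_Z(1)[OF that]
      by (intro LIMSEQ_le_const2[OF lim[OF that(1)]]) auto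
    have nonneg: "0 \<le> l \<omega>" if "?S \<omega>" for \<omega>
      by (rule LIMSEQ_le_const[OF lim[OF that]]) simp
    have "l \<in> borel_measurable M"
      unfolding l_def by measurable
    then show "l \<in> L2 M"
      by (rule L2_mono[OF z_L2]) (use seq in \<open>eventually_elim, simp add: le nonneg \<open>z \<in> Z\<close>\<close>)
    show "AE \<omega> in M. incseq (\<lambda>n. norm (x n \<omega> - x 0 \<omega>)) \<and>
        (\<lambda>n. norm (x n \<omega> - x 0 \<omega>)) \<longlonglongrightarrow> l \<omega> \<and> l \<omega> \<le> norm (?p \<omega> - x 0 \<omega>)"
      using seq
      by eventually_elim
        (intro conjI lim le haugazeau_sequence.incseq_norm haugazeau_sequence.proj_in_Z)
  qed
  have iv: "AE \<omega> in M. bounded (range (\<lambda>n. norm (x n \<omega>)))"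
    using seq
  proof eventually_elim
    case (elim \<omega>)
    then show ?case
      using haugazeau_sequence.bounded_x[OF elim] by (simp add: bounded_iff)
  qed
  have vii: "(AE \<omega> in M. (\<lambda>n. x n \<omega>) \<longlonglongrightarrow> ?p \<omega>) \<and> converges_in_L2 M x ?p"
    if cluster: "AE \<omega> in M. weak_cluster_points (\<lambda>n. x n \<omega>) \<subseteq> Z"
  proof
    show conv: "AE \<omega> in M. (\<lambda>n. x n \<omega>) \<longlonglongrightarrow> ?p \<omega>"
      using seq cluster
    proof eventually_elim
      case (elim \<omega>)
      interpret haugazeau_sequence Z "\<lambda>n. x n \<omega>" "\<lambda>n. a n \<omega>" "\<lambda>n. r n \<omega>" "\<lambda>n. lam n \<omega>"
        by fact
      obtain k w where kw: "strict_mono k" "weakly_converges ((\<lambda>n. x n \<omega>) \<circ> k) w"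
        using bounded_imp_weakly_convergent_subseq[OF bounded_x] by blast
      then have "w \<in> Z"
        using elim(2) by (auto simp: weak_cluster_points_def)
      with kw show ?case
        by (rule strongly_convergent)
    qed
    have "(\<lambda>n. \<integral>\<omega>. (norm (x n \<omega> - ?p \<omega>))\<^sup>2 \<partial>M) \<longlonglongrightarrow> (\<integral>\<omega>. 0 \<partial>M)"
    proof (rule integral_dominated_convergence)
      \<comment> \<open>The dominating function: along a path no iterate is farther from the
        projection than \<open>x 0\<close> is.\<close>
      show "integrable M (\<lambda>\<omega>. (norm (?p \<omega> - x 0 \<omega>))\<^sup>2)"
        using L2_diff[OF p_L2 assms(6)] by (simp add: L2_def)
      show "AE \<omega> in M. (\<lambda>n. (norm (x n \<omega> - ?p \<omega>))\<^sup>2) \<longlonglongrightarrow> 0"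
        using conv
        by eventually_elim (intro tendsto_null_power tendsto_norm_zero, simp_all add: LIM_zero)
      show "AE \<omega> in M. norm ((norm (x n \<omega> - ?p \<omega>))\<^sup>2) \<le> (norm (?p \<omega> - x 0 \<omega>))\<^sup>2" for n
        using seq
      proof eventually_elim
        case (elim \<omega>)
        interpret haugazeau_sequence Z "\<lambda>n. x n \<omega>" "\<lambda>n. a n \<omega>" "\<lambda>n. r n \<omega>" "\<lambda>n. lam n \<omega>"
          by fact
        show ?case
          using norm_le_dist_Z(2)[OF proj_in_Z, of n]
          by (simp add: power_mono norm_minus_commute[of "x n \<omega>"])
      qed
    qed auto
    then have "(\<lambda>n. sqrt (\<integral>\<omega>. (norm (x n \<omega> - ?p \<omega>))\<^sup>2 \<partial>M)) \<longlonglongrightarrow> 0"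
      using tendsto_real_sqrt by fastforce
    then show "converges_in_L2 M x ?p"
      using x_L2 p_L2 by (simp add: converges_in_L2_def)
  qed
  show ?thesis
    using i ii iii iv steps relaxations vii
      AE_suminf_nn_cond_exp_finite[OF subalg _ steps]
      AE_suminf_nn_cond_exp_finite[OF subalg _ relaxations]
    by auto
qed

end
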